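(* For the Combinatorial Auctions Prophet Secretary problem (defined in the context) with XOS valuations, there exists an online allocation algorithm whose expected welfare is at least $(1-1/e)\cdot\mathbb{E}[\mathrm{OPT}]$, where $\mathrm{OPT}$ is the maximum over all partitions of the items into disjoint bundles $S_1,\dots,S_n$ of $\sum_i v_i(S_i)$ for the realized valuations.
   Context: There are $n$ buyers and a set $M$ of $m$ indivisible items. Buyer $i$ has a random valuation $v_i:2^M\to\mathbb{R}_{\ge 0}$ drawn from a known distribution (with finite support), independently across buyers; every valuation in the support is XOS, i.e. of the form $v(S)=\max_{1\le \ell\le k}A_\ell(S)$ for nonnegative additive functions $A_1,\dots,A_k$. Each buyer $i$ arrives at an independent time $T_i$ uniform on $[0,1]$ (equivalently, in a uniformly random order). When a buyer arrives her valuation is revealed and the algorithm must immediately and irrevocably assign her a subset of the still-unassigned items. The welfare is $\sum_i v_i(\text{bundle assigned to } i)$; expectations are over valuations, arrival order and the algorithm's randomness. *)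

theory Defs
  imports "HOL-Probability.Probability" "HOL-Combinatorics.Multiset_Permutations"
begin

type_synonym 'a valuation = "'a set \<Rightarrow> real"

definition xos :: "'a set \<Rightarrow> 'a valuation \<Rightarrow> bool" where
  "xos M v \<longleftrightarrow> (\<exists>(k::nat) (w :: nat \<Rightarrow> 'a \<Rightarrow> real). k \<ge> 1 \<and>
      (\<forall>l<k. \<forall>j\<in>M. w l j \<ge> 0) \<and>
      (\<forall>S. S \<subseteq> M \<longrightarrow> v S = Max {(\<Sum>j\<in>S. w l j) | l. l < k}))"

text \<open>History of the online process: (buyer, revealed valuation, assigned bundle).\<close>
type_synonym 'a history = "(nat \<times> 'a valuation \<times> 'a set) list"

text \<open>An online (possibly randomized) algorithm: given the history so far and the
  identity and valuation of the currently arriving buyer, it picks a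
  (random) bundle.\<close>
type_synonym 'a online_alg = "'a history \<Rightarrow> nat \<times> 'a valuation \<Rightarrow> 'a set pmf"

definition assigned :: "'a history \<Rightarrow> 'a set" where
  "assigned h = (\<Union>x\<in>set h. snd (snd x))"

text \<open>Running the algorithm on an arrival order; only still-unassigned items of M
  can actually be given out (the chosen bundle is intersected with them).\<close>
fun run_from :: "'a set \<Rightarrow> 'a online_alg \<Rightarrow> (nat \<Rightarrow> 'a valuation) \<Rightarrow> 'a history
                   \<Rightarrow> nat list \<Rightarrow> 'a history pmf" where
  "run_from M alg v h [] = return_pmf h"
| "run_from M alg v h (i # rest) =
     bind_pmf (alg h (i, v i)) (\<lambda>A.
       run_from M alg v (h @ [(i, v i, A \<inter> (M - assigned h))]) rest)"

definition welfare :: "'a history \<Rightarrow> real" where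
  "welfare h = (\<Sum>x\<leftarrow>h. fst (snd x) (snd (snd x)))"

definition profile :: "nat \<Rightarrow> (nat \<Rightarrow> 'a valuation pmf) \<Rightarrow> (nat \<Rightarrow> 'a valuation) pmf" where
  "profile n D = Pi_pmf {..<n} (\<lambda>_. 0) D"

definition alg_welfare :: "nat \<Rightarrow> 'a set \<Rightarrow> (nat \<Rightarrow> 'a valuation pmf) \<Rightarrow> 'a online_alg \<Rightarrow> real" where
  "alg_welfare n M D alg = measure_pmf.expectation
     (bind_pmf (profile n D) (\<lambda>v.
        bind_pmf (pmf_of_set (permutations_of_set {..<n})) (\<lambda>\<sigma>.
          run_from M alg v [] \<sigma>)))
     welfare"

definition OPT :: "nat \<Rightarrow> 'a set \<Rightarrow> (nat \<Rightarrow> 'a valuation) \<Rightarrow> real" where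
  "OPT n M v = Max {(\<Sum>i<n. v i (S i)) | S.
      (\<forall>i<n. S i \<subseteq> M) \<and> (\<forall>i<n. \<forall>j<n. i \<noteq> j \<longrightarrow> S i \<inter> S j = {}) \<and>
      (\<forall>i. i \<ge> n \<longrightarrow> S i = {})}"

end

theory Submission
  imports Defs
begin

text \<open>
  When buyer \<open>i\<close> arrives with valuation \<open>v\<^sub>i\<close>, the algorithm resamples the valuations of all other buyers
  and computes the bundle \<open>S\<^sub>i\<close> of \<open>i\<close> in an optimal allocation together with an additive function
  supporting \<open>v\<^sub>i\<close> at \<open>S\<^sub>i\<close>. Since the supporting function bounds \<open>v\<^sub>i\<close> from below, one may decide for each
  free item of \<open>S\<^sub>i\<close> separately whether to hand it out, and the problem splits into single-item problems:
  item \<open>j\<close> is requested by buyer \<open>i\<close> with probability \<open>q\<^sub>i\<close> and has expected value \<open>x\<^sub>i\<close> (zero if not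
  requested), where \<open>\<Sum>q\<^sub>i \<le> 1\<close> and \<open>\<Sum>x\<^sub>i\<close> is the contribution of \<open>j\<close> to the expected optimum.

  Put \<open>\<phi>(Q) = \<integral>\<^sub>0\<^sup>1 exp(-tQ) dt = (1 - exp(-Q))/Q\<close>. If the buyers in \<open>R\<close> are still to arrive in random
  order, a free item can be made to yield at least \<open>B(R) = (\<Sum>\<^sub>R x\<^sub>i) \<phi>(\<Sum>\<^sub>R q\<^sub>i)\<close>. By induction on \<open>R\<close> this
  amounts to \<open>\<Sum>\<^sub>R (B(R-i) + max 0 (x\<^sub>i - q\<^sub>i B(R-i))) \<ge> |R| B(R)\<close>, an elementary inequality on \<open>\<phi>\<close>.
  As \<open>\<phi>(Q) \<ge> 1 - 1/e\<close> for \<open>Q \<le> 1\<close>, the bound follows by summing over the items.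
\<close>

section \<open>Estimates for \<open>exp_mean\<close>\<close>

definition exp_mean :: "real \<Rightarrow> real" where
  "exp_mean Q = (if Q = 0 then 1 else (1 - exp (- Q)) / Q)"

lemma mult_exp_mean: "Q * exp_mean Q = 1 - exp (- Q)"
  by (simp add: exp_mean_def)

lemma nonneg_if_deriv_nonneg:
  fixes f :: "real \<Rightarrow> real"
  assumes "\<And>t. t \<ge> 0 \<Longrightarrow> (f has_real_derivative f' t) (at t)"
    and "\<And>t. t \<ge> 0 \<Longrightarrow> f' t \<ge> 0" and "f 0 = 0" and "x \<ge> 0"
  shows "f x \<ge> 0"
proof -
  have "f 0 \<le> f x"
    using assms by (intro DERIV_nonneg_imp_nondecreasing[of 0 x f]) auto
  with assms show ?thesis by simp
qed

lemma exp_minus_ge_affine: "exp (- t) \<ge> 1 - (t::real)"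
  using exp_ge_add_one_self[of "-t"] by simp

lemma succ_mult_exp_minus_le: "(1 + t) * exp (- t) \<le> (1::real)"
  using exp_ge_add_one_self[of t] by (simp add: exp_minus field_simps)

lemma exp_minus_le_quadratic:
  assumes "t \<ge> (0::real)" shows "exp (- t) \<le> 1 - t + t\<^sup>2 / 2"
proof -
  have "1 - t + t\<^sup>2 / 2 - exp (- t) \<ge> 0"
    by (rule nonneg_if_deriv_nonneg[of "\<lambda>t. 1 - t + t\<^sup>2 / 2 - exp (- t)" "\<lambda>t. - 1 + t + exp (- t)"])
       (use assms exp_minus_ge_affine in \<open>auto intro!: derivative_eq_intros simp: algebra_simps\<close>)
  then show ?thesis by simp
qed

lemma two_minus_le_exp_minus:
  assumes "t \<ge> (0::real)" shows "2 - t \<le> (2 + t) * exp (- t)"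
proof -
  have "(2 + t) * exp (- t) - (2 - t) \<ge> 0"
    by (rule nonneg_if_deriv_nonneg[of "\<lambda>t. (2 + t) * exp (- t) - (2 - t)" "\<lambda>t. 1 - (1 + t) * exp (- t)"])
       (use succ_mult_exp_minus_le in \<open>auto intro!: derivative_eq_intros simp: assms algebra_simps\<close>)
  then show ?thesis by simp
qed

lemma exp_mean_ge_affine:
  assumes "y \<ge> 0" shows "exp_mean y \<ge> 1 - y / 2"
proof (cases "y = 0")
  case False
  with assms exp_minus_le_quadratic[of y] show ?thesis
    by (simp add: exp_mean_def field_simps power2_eq_square)
qed (simp add: exp_mean_def)

text \<open>The trapezoidal rule overestimates the integral of the convex function
  \<open>exp (- t * q)\<close> over [0, 1].\<close>

lemma exp_mean_le_trapezoid:
  assumes "q \<ge> 0" shows "2 * exp_mean q \<le> 1 + exp (- q)"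
proof (cases "q = 0")
  case False
  with assms two_minus_le_exp_minus[of q] show ?thesis
    by (simp add: exp_mean_def field_simps)
qed (simp add: exp_mean_def)

text \<open>Integrate \<open>1 - exp (- s) \<ge> s * exp (- s) \<ge> s * exp (- q)\<close> with
  \<open>s = t * q\<close> over \<open>t\<close> in [0, 1].\<close>

lemma exp_mean_le_one_minus:
  assumes "q \<ge> 0" shows "exp_mean q \<le> 1 - q * exp (- q) / 2"
proof (cases "q = 0")
  case False
  have "t\<^sup>2 * exp (- t) / 2 \<le> t - 1 + exp (- t)" if "t \<ge> 0" for t :: real
  proof -
    have "t - 1 + exp (- t) - t\<^sup>2 * exp (- t) / 2 \<ge> 0"
    proof (rule nonneg_if_deriv_nonneg[of "\<lambda>t. t - 1 + exp (- t) - t\<^sup>2 * exp (- t) / 2"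
        "\<lambda>t. 1 - (1 + t) * exp (- t) + t\<^sup>2 * exp (- t) / 2"])
      show "0 \<le> 1 - (1 + t) * exp (- t) + t\<^sup>2 * exp (- t) / 2" for t :: real
        using succ_mult_exp_minus_le[of t] by (smt (verit) exp_gt_zero mult_nonneg_nonneg zero_le_power2 divide_nonneg_pos)
    qed (auto intro!: derivative_eq_intros simp: that field_simps power2_eq_square)
    then show ?thesis by simp
  qed
  from this[OF assms] False assms show ?thesis
    by (simp add: exp_mean_def field_simps power2_eq_square)
qed (simp add: exp_mean_def)

lemma exp_mean_nonneg: "Q \<ge> 0 \<Longrightarrow> exp_mean Q \<ge> 0"
  by (simp add: exp_mean_def)

lemma exp_mean_le_one: "Q \<ge> 0 \<Longrightarrow> exp_mean Q \<le> 1"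
  using exp_mean_le_one_minus[of Q] by (smt (verit) exp_gt_zero mult_nonneg_nonneg divide_nonneg_pos)

lemma exp_mean_add:
  "(y + q) * exp_mean (y + q) = y * exp_mean y + exp (- y) * (q * exp_mean q)"
  unfolding mult_exp_mean by (simp add: exp_diff algebra_simps flip: exp_add)

text \<open>Ensures that the multiplier \<open>g\<close> in \<open>item_value_one_buyer\<close> is
  at most 1. After multiplication by \<open>y + q\<close> it reduces to
  \<open>exp (- y) \<le> exp_mean y \<le> 1\<close> and
  \<open>exp_mean q \<ge> 1 - q / 2\<close>.\<close>

lemma exp_mean_diff_le:
  assumes "q \<ge> 0" "y \<ge> 0"
  shows "(1 - q) * exp_mean y \<le> exp_mean (y + q)"
proof (cases "y + q = 0")
  case True
  with assms show ?thesis by (simp add: add_nonneg_eq_0_iff exp_mean_def)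
next
  case False
  with assms have pos: "y + q > 0" by simp
  define a b where "a = exp_mean y" and "b = exp_mean q"
  have E: "exp (- y) = 1 - y * a" unfolding a_def mult_exp_mean by simp
  have qb: "q * b \<ge> q - q\<^sup>2 / 2"
    using mult_left_mono[OF exp_mean_ge_affine[OF assms(1)] assms(1)]
    by (simp add: b_def algebra_simps power2_eq_square)
  have a1: "exp (- y) \<le> a"
    using succ_mult_exp_minus_le[of y] assms
    by (cases "y = 0") (auto simp: a_def exp_mean_def field_simps)
  have "q * a \<le> q" and "q * exp (- y) \<le> q * a" and "q * q * exp (- y) \<le> q * q * a"
    using mult_left_mono[OF exp_mean_le_one[OF assms(2)] assms(1)]
      mult_left_mono[OF a1, of q] mult_left_mono[OF a1, of "q * q"] assms
    by (simp_all add: a_def)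
  moreover have "q * q * a \<ge> 0" using exp_mean_nonneg assms by (simp add: a_def)
  moreover have "exp (- y) * (q - q\<^sup>2 / 2) \<le> exp (- y) * (q * b)"
    using qb by (intro mult_left_mono) auto
  moreover have "(y + q) * ((1 - q) * a) = y * a + q * a - q * (1 - exp (- y)) - q * q * a"
    unfolding E by (simp add: algebra_simps)
  ultimately have "(y + q) * ((1 - q) * a) \<le> y * a + exp (- y) * (q * b)"
    by (simp add: algebra_simps power2_eq_square)
  also have "\<dots> = (y + q) * exp_mean (y + q)"
    unfolding exp_mean_add a_def b_def ..
  finally show ?thesis using pos by (simp add: a_def)
qed

text \<open>Used for the sign of the coefficient of \<open>X\<close> in
  \<open>item_value_one_buyer\<close>. Times \<open>y + q\<close>, the gap between the sides has the
  factor \<open>exp (- y)\<close>; the cofactor is a sum of three nonnegative terms.\<close>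

lemma exp_mean_split:
  assumes "q \<ge> 0" "y \<ge> 0"
  shows "exp_mean (y + q) * (1 + q * exp_mean y)
    \<le> exp_mean y + exp (- y) * (1 - exp_mean q)"
proof (cases "y + q = 0")
  case True
  with assms show ?thesis by (simp add: add_nonneg_eq_0_iff exp_mean_def)
next
  case False
  with assms have pos: "y + q > 0" by simp
  define a b where "a = exp_mean y" and "b = exp_mean q"
  have E: "exp (- y) = 1 - y * a" unfolding a_def mult_exp_mean by simp
  have Eq: "exp (- q) = 1 - q * b" unfolding b_def mult_exp_mean by simp
  \<comment> \<open>In the sum of these two terms and the next one, the parts
    \<open>q * exp (- q)\<close> and \<open>y * q * exp (- q) / 2\<close> cancel.\<close>
  have "y * (1 - b - q * exp (- q) / 2) \<ge> 0" "q * (1 - 2 * b + exp (- q)) \<ge> 0"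
    using exp_mean_le_one_minus[OF assms(1)] exp_mean_le_trapezoid[OF assms(1)] assms
    by (auto simp: b_def)
  moreover have "q * exp (- q) * (a - (1 - y / 2)) \<ge> 0"
    using exp_mean_ge_affine[OF assms(2)] assms by (auto simp: a_def)
  ultimately have "y * (1 - b) + q * (1 - 2 * b + a * exp (- q)) \<ge> 0"
    by (simp add: algebra_simps)
  then have "exp (- y) * (y * (1 - b) + q * (1 - 2 * b + a * exp (- q))) \<ge> 0"
    by simp
  also have "exp (- y) * (y * (1 - b) + q * (1 - 2 * b + a * exp (- q)))
      = (y + q) * (a + exp (- y) * (1 - b)) - (y * a + exp (- y) * (q * b)) * (1 + q * a)"
    unfolding E Eq by (simp add: algebra_simps)
  also have "y * a + exp (- y) * (q * b) = (y + q) * exp_mean (y + q)"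
    unfolding exp_mean_add a_def b_def ..
  finally have "(y + q) * (exp_mean (y + q) * (1 + q * a)) \<le> (y + q) * (a + exp (- y) * (1 - b))"
    by (simp add: algebra_simps)
  then show ?thesis using pos by (simp add: a_def b_def)
qed

section \<open>The single-item inequality\<close>

text \<open>The affine left-hand side is the first-order expansion of the right-hand side in \<open>(x, q)\<close> at
  \<open>(0, 0)\<close>; it is chosen so that the correction terms cancel when summed over all buyers.
  The multiplier \<open>g\<close> is the acceptance probability that makes both sides have the same slope in \<open>x\<close>.\<close>

lemma item_value_one_buyer:
  assumes "q \<ge> 0" "q \<le> Q" "Q > 0" "X \<ge> 0"
  shows "X * exp_mean Q + (1 - exp_mean Q) * (x - X * q / Q)
    \<le> (X - x) * exp_mean (Q - q) + max 0 (x - q * ((X - x) * exp_mean (Q - q)))"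
proof -
  define y where "y = Q - q"
  define f p where "f = exp_mean Q" and "p = exp_mean y"
  have y: "y \<ge> 0" "Q = y + q" using assms by (auto simp: y_def)
  have p: "p \<ge> 0" using exp_mean_nonneg y by (simp add: p_def)
  have f: "f \<le> 1" using exp_mean_le_one assms by (simp add: f_def)
  have d: "1 + q * p > 0" using p assms by (smt (verit) mult_nonneg_nonneg)
  define g where "g = (1 - f + p) / (1 + q * p)"
  have gd: "g * (1 + q * p) = 1 - f + p" using d by (simp add: g_def)
  have "g \<ge> 0" using p f d by (simp add: g_def)
  moreover have "g \<le> 1"
    using exp_mean_diff_le[of q y] d assms y by (simp add: g_def f_def p_def algebra_simps)
  ultimately have mx: "max 0 t \<ge> g * t" for t :: real
    by (cases "t \<ge> 0") (auto simp: mult_left_le_one_le mult_nonneg_nonpos)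
  \<comment> \<open>Once the maximum is bounded by \<open>g\<close> times its argument,
    \<open>?c\<close> is the coefficient of \<open>X\<close>, and that of \<open>x\<close> vanishes
    by the choice of \<open>g\<close>.\<close>
  have "p * (1 - g * q) - f + (1 - f) * q / Q \<ge> 0" (is "?c \<ge> 0")
  proof -
    define b where "b = exp_mean q"
    have E: "exp (- y) = 1 - y * p" unfolding p_def mult_exp_mean by simp
    have Qf: "Q * f = y * p + exp (- y) * (q * b)"
      unfolding y(2) f_def p_def b_def exp_mean_add ..
    \<comment> \<open>Clearing both denominators leaves \<open>q\<close> times the slack of
      \<open>exp_mean_split\<close>.\<close>
    have "?c * (1 + q * p) * Q
        = Q * (p * (1 + q * p) - q * p * (g * (1 + q * p)) - f * (1 + q * p)) + (1 - f) * q * (1 + q * p)"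
      using assms by (simp add: field_simps)
    also have "\<dots> = Q * p - Q * q * p - Q * f + (1 - f) * q * (1 + q * p)"
      unfolding gd by (simp add: algebra_simps)
    also have "\<dots> = q * (p + exp (- y) * (1 - b) - f * (1 + q * p))"
      unfolding Qf E unfolding y(2) by (simp add: algebra_simps)
    also have "\<dots> \<ge> 0"
      using exp_mean_split[OF assms(1) y(1)] assms by (simp add: f_def p_def b_def y(2))
    finally show ?thesis
      using assms d by (simp add: zero_le_mult_iff)
  qed
  then have "0 \<le> X * ?c" using assms by simp
  also have "X * ?c = (X - x) * p + g * (x - q * ((X - x) * p)) - (X * f + (1 - f) * (x - X * q / Q))
       - x * (g * (1 + q * p) - (1 - f + p))"
    by (simp add: algebra_simps)
  finally show ?thesis
    using mx[of "x - q * ((X - x) * p)"] unfolding gd by (simp add: f_def p_def y_def)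
qed

text \<open>Sums the one-buyer bound over the possible next arrivals; \<open>max 0\<close> is the
  option of letting buyer \<open>i\<close> have the item.\<close>

lemma item_value_step:
  fixes x q :: "'b \<Rightarrow> real"
  assumes fin: "finite R" and x: "\<And>i. i \<in> R \<Longrightarrow> x i \<ge> 0" and q: "\<And>i. i \<in> R \<Longrightarrow> q i \<ge> 0"
  defines "B \<equiv> \<lambda>R. sum x R * exp_mean (sum q R)"
  shows "real (card R) * B R \<le> (\<Sum>i\<in>R. B (R - {i}) + max 0 (x i - q i * B (R - {i})))"
proof -
  define X Q where "X = sum x R" and "Q = sum q R"
  have B: "B (R - {i}) = (X - x i) * exp_mean (Q - q i)" if "i \<in> R" for i
    using that fin by (simp add: B_def X_def Q_def sum_diff1)
  have X0: "X \<ge> 0" and Q0: "Q \<ge> 0" using x q by (auto simp: X_def Q_def intro: sum_nonneg)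
  show ?thesis
  proof (cases "Q = 0")
    \<comment> \<open>Avoids dividing by \<open>Q = 0\<close>: all rates vanish, so each summand is
      at least \<open>(X - x i) + x i = X\<close>.\<close>
    case True
    then have q0: "q i = 0" if "i \<in> R" for i
      using that fin q by (simp add: Q_def sum_nonneg_eq_0_iff)
    have "real (card R) * B R = (\<Sum>i\<in>R. X)"
      by (simp add: B_def exp_mean_def True flip: X_def Q_def)
    also have "\<dots> \<le> (\<Sum>i\<in>R. B (R - {i}) + max 0 (x i - q i * B (R - {i})))"
      by (intro sum_mono) (simp add: B q0 True exp_mean_def)
    finally show ?thesis .
  next
    case False
    have "(\<Sum>i\<in>R. X * exp_mean Q + (1 - exp_mean Q) * (x i - X * q i / Q))
        = real (card R) * (X * exp_mean Q) + (1 - exp_mean Q) * (X - X * Q / Q)"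
      by (simp add: sum.distrib sum_subtractf X_def Q_def flip: sum_distrib_left sum_divide_distrib)
    also have "\<dots> = real (card R) * B R"
      using False by (simp add: B_def flip: X_def Q_def)
    finally have "real (card R) * B R
        = (\<Sum>i\<in>R. X * exp_mean Q + (1 - exp_mean Q) * (x i - X * q i / Q))" ..
    also have "\<dots> \<le> (\<Sum>i\<in>R. B (R - {i}) + max 0 (x i - q i * B (R - {i})))"
    proof (rule sum_mono)
      fix i assume "i \<in> R"
      then have "q i \<le> Q" unfolding Q_def using fin q by (intro member_le_sum) auto
      then show "X * exp_mean Q + (1 - exp_mean Q) * (x i - X * q i / Q)
          \<le> B (R - {i}) + max 0 (x i - q i * B (R - {i}))"
        unfolding B[OF \<open>i \<in> R\<close>] using False Q0 X0 q \<open>i \<in> R\<close>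
        by (intro item_value_one_buyer) auto
    qed
    finally show ?thesis .
  qed
qed

text \<open>Convexity puts \<open>exp (- Q)\<close> below the chord of \<open>exp\<close> over
  [-1, 0]; the bound is attained at \<open>Q = 1\<close>.\<close>

lemma exp_mean_ge_one_minus_inverse_e:
  assumes "Q \<ge> 0" "Q \<le> 1"
  shows "1 - 1 / exp 1 \<le> exp_mean Q"
proof (cases "Q = 0")
  case True
  then show ?thesis by (simp add: exp_mean_def)
next
  case False
  have "exp (- Q) = exp ((1 - Q) *\<^sub>R 0 + Q *\<^sub>R (- 1))" by simp
  also have "\<dots> \<le> (1 - Q) * exp 0 + Q * exp (- 1)"
    using assms by (intro convex_onD[OF exp_convex]) auto
  finally show ?thesis using False assms by (simp add: exp_mean_def exp_minus field_simps)
qed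

section \<open>One-step recursion for the online process\<close>

lemma run_from_cong:
  "(\<And>i. i \<in> set \<sigma> \<Longrightarrow> v i = v' i) \<Longrightarrow> run_from M alg v h \<sigma> = run_from M alg v' h \<sigma>"
  by (induction \<sigma> arbitrary: h) auto

lemma finite_set_run_from:
  assumes "\<And>h i. finite (set_pmf (alg h (i, v i)))"
  shows "finite (set_pmf (run_from M alg v h \<sigma>))"
  using assms by (induction \<sigma> arbitrary: h) auto

lemma profile_split:
  assumes "i < n"
  shows "profile n D = bind_pmf (D i) (\<lambda>y.
    map_pmf (\<lambda>f. f(i := y)) (Pi_pmf ({..<n} - {i}) (\<lambda>_. 0) D))"
proof -
  have "{..<n} = insert i ({..<n} - {i})" using assms by auto
  then have "profile n D = Pi_pmf (insert i ({..<n} - {i})) (\<lambda>_. 0) D"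
    by (simp only: profile_def)
  also have "\<dots> = bind_pmf (D i) (\<lambda>y. map_pmf (\<lambda>f. f(i := y)) (Pi_pmf ({..<n} - {i}) (\<lambda>_. 0) D))"
    by (subst Pi_pmf_insert') (auto simp: map_pmf_def)
  finally show ?thesis .
qed

lemma profile_resample:
  assumes "i < n"
  shows "bind_pmf (D i) (\<lambda>y. map_pmf (\<lambda>v. v(i := y)) (profile n D)) = profile n D"
  unfolding profile_split[OF assms]
  by (simp add: map_bind_pmf pmf.map_comp o_def)

text \<open>A run reads only the coordinates of buyers still to come, so a full fresh profile can be
  drawn at every stage, which gives a recursion in \<open>R\<close>.\<close>

definition play :: "nat \<Rightarrow> 'a set \<Rightarrow> (nat \<Rightarrow> 'a valuation pmf) \<Rightarrow> 'a online_alg \<Rightarrow> 'a history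
    \<Rightarrow> nat set \<Rightarrow> 'a history pmf" where
  "play n M D alg h R = bind_pmf (profile n D) (\<lambda>v.
     bind_pmf (pmf_of_set (permutations_of_set R)) (run_from M alg v h))"

lemma play_empty: "play n M D alg h {} = return_pmf h"
  by (simp add: play_def bind_return_pmf pmf_of_set_singleton)

text \<open>Coordinate \<open>i\<close> is independent of the others and never read along
  \<open>\<sigma>\<close>, so it can be drawn first and redrawn later.\<close>

lemma run_from_profile_Cons:
  assumes "i < n" "i \<notin> set \<sigma>"
  shows "bind_pmf (profile n D) (\<lambda>v. run_from M alg v h (i # \<sigma>))
    = bind_pmf (D i) (\<lambda>y. bind_pmf (alg h (i, y)) (\<lambda>A. bind_pmf (profile n D) (\<lambda>v.
        run_from M alg v (h @ [(i, y, A \<inter> (M - assigned h))]) \<sigma>)))"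
proof -
  have upd: "run_from M alg (f(i := y)) h \<sigma> = run_from M alg f h \<sigma>" for f y h
    using assms by (intro run_from_cong) auto
  have rest: "bind_pmf (Pi_pmf ({..<n} - {i}) (\<lambda>_. 0) D) (\<lambda>f. run_from M alg f h' \<sigma>)
      = bind_pmf (profile n D) (\<lambda>v. run_from M alg v h' \<sigma>)" for h'
    by (simp add: profile_split[OF assms(1)] bind_assoc_pmf bind_map_pmf upd)
  have "bind_pmf (profile n D) (\<lambda>v. run_from M alg v h (i # \<sigma>))
    = bind_pmf (D i) (\<lambda>y. bind_pmf (Pi_pmf ({..<n} - {i}) (\<lambda>_. 0) D) (\<lambda>f.
        bind_pmf (alg h (i, y)) (\<lambda>A. run_from M alg f (h @ [(i, y, A \<inter> (M - assigned h))]) \<sigma>)))"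
    by (simp add: profile_split[OF assms(1)] bind_assoc_pmf bind_map_pmf upd)
  also have "\<dots> = bind_pmf (D i) (\<lambda>y. bind_pmf (alg h (i, y)) (\<lambda>A.
        bind_pmf (Pi_pmf ({..<n} - {i}) (\<lambda>_. 0) D) (\<lambda>f.
          run_from M alg f (h @ [(i, y, A \<inter> (M - assigned h))]) \<sigma>)))"
    by (subst bind_commute_pmf) (rule refl)
  finally show ?thesis by (simp only: rest)
qed

lemma play_step:
  assumes "R \<noteq> {}" "R \<subseteq> {..<n}"
  shows "play n M D alg h R = bind_pmf (pmf_of_set R) (\<lambda>i. bind_pmf (D i) (\<lambda>y.
    bind_pmf (alg h (i, y)) (\<lambda>A. play n M D alg (h @ [(i, y, A \<inter> (M - assigned h))]) (R - {i}))))"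
proof -
  have fin: "finite R" using assms finite_subset by auto
  let ?P = "\<lambda>i. pmf_of_set (permutations_of_set (R - {i}))"
  have rest: "bind_pmf (?P i) (\<lambda>\<sigma>. bind_pmf (profile n D) (\<lambda>v. run_from M alg v h' \<sigma>))
      = play n M D alg h' (R - {i})" for i h'
    unfolding play_def by (rule bind_commute_pmf)
  have "play n M D alg h R = bind_pmf (pmf_of_set R) (\<lambda>i. bind_pmf (?P i) (\<lambda>\<sigma>.
      bind_pmf (profile n D) (\<lambda>v. run_from M alg v h (i # \<sigma>))))"
    unfolding play_def random_permutation_of_set[OF fin assms(1)]
    by (subst bind_commute_pmf) (simp add: bind_assoc_pmf bind_return_pmf del: run_from.simps)
  also have "\<dots> = bind_pmf (pmf_of_set R) (\<lambda>i. bind_pmf (?P i) (\<lambda>\<sigma>.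
      bind_pmf (D i) (\<lambda>y. bind_pmf (alg h (i, y)) (\<lambda>A. bind_pmf (profile n D) (\<lambda>v.
        run_from M alg v (h @ [(i, y, A \<inter> (M - assigned h))]) \<sigma>)))))"
    using assms fin
    by (intro bind_pmf_cong refl run_from_profile_Cons)
       (auto simp: permutations_of_set_nonempty dest: permutations_of_setD)
  also have "\<dots> = bind_pmf (pmf_of_set R) (\<lambda>i. bind_pmf (D i) (\<lambda>y. bind_pmf (alg h (i, y)) (\<lambda>A.
      bind_pmf (?P i) (\<lambda>\<sigma>. bind_pmf (profile n D) (\<lambda>v.
        run_from M alg v (h @ [(i, y, A \<inter> (M - assigned h))]) \<sigma>)))))"
    by (intro bind_pmf_cong refl, subst bind_commute_pmf, intro bind_pmf_cong refl,
        subst bind_commute_pmf) (rule refl)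
  finally show ?thesis by (simp only: rest)
qed

lemma welfare_append: "welfare (h @ [(i, y, A)]) = welfare h + y A"
  by (simp add: welfare_def)

lemma assigned_append: "assigned (h @ [(i, y, A)]) = assigned h \<union> A"
  by (auto simp: assigned_def)

section \<open>The resampling algorithm and its analysis\<close>

text \<open>In the application, \<open>S v\<close> is an optimal allocation for the profile \<open>v\<close> and \<open>a v i\<close> an
  additive function of the XOS representation of \<open>v i\<close> attaining \<open>v i (S v i)\<close>.\<close>

locale item_assignment =
  fixes n :: nat and M :: "'a set" and D :: "nat \<Rightarrow> 'a valuation pmf"
    and S :: "(nat \<Rightarrow> 'a valuation) \<Rightarrow> nat \<Rightarrow> 'a set"
    and a :: "(nat \<Rightarrow> 'a valuation) \<Rightarrow> nat \<Rightarrow> 'a \<Rightarrow> real"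
  assumes finM: "finite M"
    and finD: "\<And>i. i < n \<Longrightarrow> finite (set_pmf (D i))"
    and S_subset: "\<And>v i. v \<in> set_pmf (profile n D) \<Longrightarrow> i < n \<Longrightarrow> S v i \<subseteq> M"
    and S_disjoint: "\<And>v i k. v \<in> set_pmf (profile n D) \<Longrightarrow> i < n \<Longrightarrow> k < n \<Longrightarrow> i \<noteq> k
        \<Longrightarrow> S v i \<inter> S v k = {}"
    and a_nonneg: "\<And>v i j. v \<in> set_pmf (profile n D) \<Longrightarrow> i < n \<Longrightarrow> j \<in> M \<Longrightarrow> a v i j \<ge> 0"
    and a_supports: "\<And>v i T. v \<in> set_pmf (profile n D) \<Longrightarrow> i < n \<Longrightarrow> T \<subseteq> S v i
        \<Longrightarrow> (\<Sum>j\<in>T. a v i j) \<le> v i T"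
begin

definition share :: "nat \<Rightarrow> 'a \<Rightarrow> real" where
  "share i j = measure_pmf.expectation (profile n D) (\<lambda>v. if j \<in> S v i then a v i j else 0)"

definition rate :: "nat \<Rightarrow> 'a \<Rightarrow> real" where
  "rate i j = measure_pmf.expectation (profile n D) (\<lambda>v. if j \<in> S v i then 1 else 0)"

definition item_value :: "'a \<Rightarrow> nat set \<Rightarrow> real" where
  "item_value j R = (\<Sum>i\<in>R. share i j) * exp_mean (\<Sum>i\<in>R. rate i j)"

text \<open>\<open>item_value j R\<close> is a lower bound for the gain from the free item \<open>j\<close> when the buyers in \<open>R\<close>
  are still to come. Giving \<open>j\<close> to \<open>i\<close> whenever \<open>j\<close> lies in her resampled bundle gains \<open>share i j\<close>
  and loses \<open>rate i j * item_value j (R - {i})\<close> in expectation.\<close>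

definition accepts :: "nat set \<Rightarrow> nat \<Rightarrow> 'a \<Rightarrow> bool" where
  "accepts R i j \<longleftrightarrow> rate i j * item_value j (R - {i}) \<le> share i j"

definition remaining :: "'a history \<Rightarrow> nat set" where
  "remaining h = {..<n} - fst ` set h"

text \<open>On arrival, \<open>h\<close> does not yet list buyer \<open>i\<close>, so
  \<open>remaining h\<close> still contains her; \<open>accepts\<close> removes her. Items already
  given away may occur, and \<open>run_from\<close> filters them out.\<close>

definition offer :: "'a history \<Rightarrow> nat \<Rightarrow> (nat \<Rightarrow> 'a valuation) \<Rightarrow> 'a set" where
  "offer h i v = {j \<in> S v i. accepts (remaining h) i j}"

definition resampling_alg :: "'a online_alg" where
  "resampling_alg h b = map_pmf (\<lambda>v. offer h (fst b) (v(fst b := snd b))) (profile n D)"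

lemma finite_profile: "finite (set_pmf (profile n D))"
  unfolding profile_def using finD by (subst set_Pi_pmf) (auto intro!: finite_PiE_dflt)

lemma integrable_profile [simp]: "integrable (measure_pmf (profile n D)) (f :: _ \<Rightarrow> real)"
  by (rule integrable_measure_pmf_finite[OF finite_profile])

lemma finite_play: "finite R \<Longrightarrow> finite (set_pmf (play n M D resampling_alg h R))"
  unfolding play_def
  by (auto simp: finite_profile resampling_alg_def permutations_of_set_nonempty intro!: finite_set_run_from)

lemma share_nonneg: "i < n \<Longrightarrow> j \<in> M \<Longrightarrow> share i j \<ge> 0"
  unfolding share_def
  by (rule integral_nonneg_AE) (auto simp: AE_measure_pmf_iff a_nonneg)

lemma rate_nonneg: "rate i j \<ge> 0"
  unfolding rate_def by (rule integral_nonneg_AE) auto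

lemma sum_rate_le_one: "(\<Sum>i<n. rate i j) \<le> 1"
proof -
  have "(\<Sum>i<n. if j \<in> S v i then 1 else 0 :: real) \<le> 1" if v: "v \<in> set_pmf (profile n D)" for v
  proof -
    have "card {i \<in> {..<n}. j \<in> S v i} \<le> 1"
      using S_disjoint[OF v] by (auto simp: card_le_Suc0_iff_eq)
    then show ?thesis by (simp add: sum.If_cases Int_def)
  qed
  then have "measure_pmf.expectation (profile n D) (\<lambda>v. \<Sum>i<n. if j \<in> S v i then 1 else 0 :: real)
      \<le> measure_pmf.expectation (profile n D) (\<lambda>v. 1)"
    by (intro integral_mono_AE) (auto simp: AE_measure_pmf_iff)
  then show ?thesis by (simp add: rate_def Bochner_Integration.integral_sum)
qed

text \<open>The true valuation inserted into the sampled profile is again a sample of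
  \<open>profile n D\<close>, so one profile governs both the valuation and the offer.\<close>

lemma arrival_resampled:
  assumes "i < n"
  shows "bind_pmf (D i) (\<lambda>y. bind_pmf (resampling_alg h (i, y)) (\<lambda>A. F y A))
    = bind_pmf (profile n D) (\<lambda>v. F (v i) (offer h i v))"
proof -
  have "bind_pmf (profile n D) (\<lambda>v. F (v i) (offer h i v))
     = bind_pmf (bind_pmf (D i) (\<lambda>y. map_pmf (\<lambda>v. v(i := y)) (profile n D)))
         (\<lambda>v. F (v i) (offer h i v))"
    by (simp only: profile_resample[OF assms])
  then show ?thesis
    by (simp add: resampling_alg_def bind_assoc_pmf bind_map_pmf)
qed

text \<open>The left-hand side is a potential: by \<open>item_value_step\<close> its expectation
  does not fall at an arrival.\<close>

lemma expected_welfare_play: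
  assumes "remaining h = R"
  shows "welfare h + (\<Sum>j\<in>M - assigned h. item_value j R)
    \<le> measure_pmf.expectation (play n M D resampling_alg h R) welfare"
  using assms
proof (induction "card R" arbitrary: h R)
  case 0
  then have "R = {}" by (auto simp: remaining_def)
  then show ?case by (simp add: play_empty item_value_def)
next
  case (Suc m)
  have R: "finite R" "R \<noteq> {}" "R \<subseteq> {..<n}"
    using Suc.hyps(2) Suc.prems by (auto simp: remaining_def)
  let ?U = "M - assigned h"
  let ?h = "\<lambda>i v. h @ [(i, v i, offer h i v \<inter> ?U)]"
  let ?E = "measure_pmf.expectation"
  have step: "?E (bind_pmf (profile n D) (\<lambda>v. play n M D resampling_alg (?h i v) (R - {i}))) welfare
      \<ge> welfare h + (\<Sum>j\<in>?U. item_value j (R - {i})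
            + max 0 (share i j - rate i j * item_value j (R - {i})))" (is "?lhs \<ge> ?rhs")
    if i: "i \<in> R" for i
  proof -
    let ?V = "\<lambda>j. item_value j (R - {i})"
    let ?acc = "\<lambda>j. if accepts R i j then 1 else 0 :: real"
    have "i < n" using i R by auto
    \<comment> \<open>For a fixed profile, a handed-out item trades its continuation value for
      \<open>a v i j\<close>. The linear form in the indicators turns into \<open>share\<close> and
      \<open>rate\<close> under expectation.\<close>
    have pw: "welfare h + (\<Sum>j\<in>?U. ?V j + ?acc j * ((if j \<in> S v i then a v i j else 0)
            - (if j \<in> S v i then 1 else 0) * ?V j))
        \<le> ?E (play n M D resampling_alg (?h i v) (R - {i})) welfare"
      if v: "v \<in> set_pmf (profile n D)" for v
    proof -
      let ?A = "offer h i v \<inter> ?U"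
      have A: "?A \<subseteq> S v i" by (auto simp: offer_def)
      have left: "M - assigned (?h i v) = ?U - ?A" by (auto simp: assigned_append)
      have "(\<Sum>j\<in>?U. ?V j + ?acc j * ((if j \<in> S v i then a v i j else 0)
            - (if j \<in> S v i then 1 else 0) * ?V j))
          = (\<Sum>j\<in>?U. if j \<in> ?A then a v i j else ?V j)"
        by (intro sum.cong refl) (auto simp: offer_def Suc.prems)
      also have "\<dots> = (\<Sum>j\<in>?A. a v i j) + (\<Sum>j\<in>?U - ?A. ?V j)"
      proof -
        have "?U \<inter> {j. j \<in> ?A} = ?A" "?U \<inter> - {j. j \<in> ?A} = ?U - ?A" by auto
        then show ?thesis using finM by (simp only: sum.If_cases finite_Diff)
      qed
      also have "(\<Sum>j\<in>?A. a v i j) \<le> v i ?A"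
        by (rule a_supports[OF v \<open>i < n\<close> A])
      finally have "welfare h + (\<Sum>j\<in>?U. ?V j + ?acc j * ((if j \<in> S v i then a v i j else 0)
            - (if j \<in> S v i then 1 else 0) * ?V j))
          \<le> welfare (?h i v) + (\<Sum>j\<in>M - assigned (?h i v). ?V j)"
        by (simp add: welfare_append left)
      also have "\<dots> \<le> ?E (play n M D resampling_alg (?h i v) (R - {i})) welfare"
        using Suc.hyps(2) Suc.prems i R
        by (intro Suc.hyps(1)) (auto simp: remaining_def)
      finally show ?thesis .
    qed
    \<comment> \<open>\<open>accepts\<close> tests the sign of the difference, so the factor
      \<open>?acc\<close> realises the maximum.\<close>
    have "?rhs = welfare h + (\<Sum>j\<in>?U. ?V j + ?acc j * (share i j - rate i j * ?V j))"
      by (intro arg_cong2[where f = "(+)"] sum.cong refl) (auto simp: accepts_def)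
    also have "\<dots> = ?E (profile n D) (\<lambda>v. welfare h + (\<Sum>j\<in>?U. ?V j
        + ?acc j * ((if j \<in> S v i then a v i j else 0) - (if j \<in> S v i then 1 else 0) * ?V j)))"
      by (simp add: share_def rate_def Bochner_Integration.integral_sum Bochner_Integration.integral_add Bochner_Integration.integral_diff)
    also have "\<dots> \<le> ?E (profile n D) (\<lambda>v. ?E (play n M D resampling_alg (?h i v) (R - {i})) welfare)"
      by (intro integral_mono_AE) (auto simp: AE_measure_pmf_iff pw)
    also have "\<dots> = ?lhs"
      using finite_profile finite_play R
      by (subst pmf_expectation_bind[OF finite_profile]) (auto simp: integral_measure_pmf[OF finite_profile])
    finally show ?thesis .
  qed
  have "real (card R) * (welfare h + (\<Sum>j\<in>?U. item_value j R))
      = real (card R) * welfare h + (\<Sum>j\<in>?U. real (card R) * item_value j R)"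
    by (simp add: algebra_simps sum_distrib_left)
  also have "\<dots> \<le> real (card R) * welfare h + (\<Sum>j\<in>?U. \<Sum>i\<in>R. item_value j (R - {i})
        + max 0 (share i j - rate i j * item_value j (R - {i})))"
    unfolding item_value_def using R share_nonneg rate_nonneg
    by (intro add_left_mono sum_mono item_value_step) auto
  also have "\<dots> = (\<Sum>i\<in>R. welfare h + (\<Sum>j\<in>?U. item_value j (R - {i})
        + max 0 (share i j - rate i j * item_value j (R - {i}))))"
    by (subst sum.swap) (simp add: sum.distrib)
  also have "\<dots> \<le> (\<Sum>i\<in>R. ?E (bind_pmf (profile n D)
      (\<lambda>v. play n M D resampling_alg (?h i v) (R - {i}))) welfare)"
    by (intro sum_mono step)
  also have "\<dots> = real (card R) * ?E (bind_pmf (pmf_of_set R) (\<lambda>i. bind_pmf (profile n D)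
      (\<lambda>v. play n M D resampling_alg (?h i v) (R - {i})))) welfare"
    using R finite_profile finite_play
    by (subst pmf_expectation_bind_pmf_of_set)
       (auto simp: sum_distrib_left card_gt_0_iff simp flip: mult.assoc)
  also have "bind_pmf (pmf_of_set R) (\<lambda>i. bind_pmf (profile n D)
      (\<lambda>v. play n M D resampling_alg (?h i v) (R - {i}))) = play n M D resampling_alg h R"
    unfolding play_step[OF R(2,3)] using R by (intro bind_pmf_cong refl arrival_resampled[symmetric]) auto
  finally show ?case using R by (simp add: card_gt_0_iff)
qed

lemma alg_welfare_ge:
  "(1 - 1 / exp 1) * measure_pmf.expectation (profile n D) (\<lambda>v. \<Sum>i<n. \<Sum>j\<in>S v i. a v i j)
    \<le> alg_welfare n M D resampling_alg"
proof -
  have "measure_pmf.expectation (profile n D) (\<lambda>v. \<Sum>i<n. \<Sum>j\<in>S v i. a v i j)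
      = measure_pmf.expectation (profile n D) (\<lambda>v. \<Sum>j\<in>M. \<Sum>i<n. if j \<in> S v i then a v i j else 0)"
  proof (intro integral_cong_AE)
    have "(\<Sum>j\<in>S v i. a v i j) = (\<Sum>j\<in>M. if j \<in> S v i then a v i j else 0)"
      if "v \<in> set_pmf (profile n D)" "i < n" for v i
      using S_subset[OF that] finM by (simp add: sum.If_cases Int_absorb1 flip: Int_def)
    then show "AE v in profile n D. (\<Sum>i<n. \<Sum>j\<in>S v i. a v i j)
        = (\<Sum>j\<in>M. \<Sum>i<n. if j \<in> S v i then a v i j else 0)"
      by (subst sum.swap) (auto simp: AE_measure_pmf_iff)
  qed auto
  also have "\<dots> = (\<Sum>j\<in>M. \<Sum>i<n. share i j)"
    by (simp add: share_def Bochner_Integration.integral_sum)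
  finally have sum: "measure_pmf.expectation (profile n D) (\<lambda>v. \<Sum>i<n. \<Sum>j\<in>S v i. a v i j)
      = (\<Sum>j\<in>M. \<Sum>i<n. share i j)" .
  have "(1 - 1 / exp 1) * measure_pmf.expectation (profile n D) (\<lambda>v. \<Sum>i<n. \<Sum>j\<in>S v i. a v i j)
      = (\<Sum>j\<in>M. (\<Sum>i<n. share i j) * (1 - 1 / exp 1))"
    unfolding sum by (subst mult.commute) (rule sum_distrib_right)
  also have "\<dots> \<le> (\<Sum>j\<in>M. item_value j {..<n})"
    unfolding item_value_def
    by (intro sum_mono mult_left_mono exp_mean_ge_one_minus_inverse_e sum_nonneg sum_rate_le_one)
       (auto simp: share_nonneg rate_nonneg)
  also have "\<dots> \<le> measure_pmf.expectation (play n M D resampling_alg [] {..<n}) welfare"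
    using expected_welfare_play[of "[]" "{..<n}"] by (simp add: welfare_def assigned_def remaining_def)
  also have "\<dots> = alg_welfare n M D resampling_alg"
    by (simp add: alg_welfare_def play_def)
  finally show ?thesis .
qed

end

section \<open>Supporting prices and optimal allocations\<close>

text \<open>Take the additive function attaining the maximum at \<open>T\<close>; elsewhere it is
  one of the competitors in the maximum.\<close>

lemma xos_supporting_prices:
  assumes "xos M v" "T \<subseteq> M"
  shows "\<exists>w. (\<forall>j\<in>M. w j \<ge> 0) \<and> v T = sum w T \<and> (\<forall>T'\<subseteq>M. sum w T' \<le> v T')"
proof -
  obtain k :: nat and w :: "nat \<Rightarrow> 'a \<Rightarrow> real" where k: "k \<ge> 1" "\<forall>l<k. \<forall>j\<in>M. w l j \<ge> 0"
    and v: "\<And>U. U \<subseteq> M \<Longrightarrow> v U = Max {sum (w l) U | l. l < k}"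
    using assms(1) unfolding xos_def by blast
  have vU: "v U = Max ((\<lambda>l. sum (w l) U) ` {..<k})" if "U \<subseteq> M" for U
    unfolding v[OF that] by (intro arg_cong[where f = Max]) auto
  have "v T \<in> (\<lambda>l. sum (w l) T) ` {..<k}"
    unfolding vU[OF assms(2)] using k by (intro Max_in) (auto simp: lessThan_empty_iff)
  then obtain l where l: "l < k" "v T = sum (w l) T" by auto
  have "sum (w l) T' \<le> v T'" if "T' \<subseteq> M" for T'
    unfolding vU[OF that] using l by (intro Max_ge) auto
  with l k show ?thesis by (intro exI[of _ "w l"]) simp
qed

lemma OPT_attained:
  assumes "finite M"
  shows "\<exists>S. (\<forall>i<n. S i \<subseteq> M) \<and> (\<forall>i<n. \<forall>k<n. i \<noteq> k \<longrightarrow> S i \<inter> S k = {}) \<and>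
    OPT n M v = (\<Sum>i<n. v i (S i))"
proof -
  let ?P = "\<lambda>S. (\<forall>i<n. S i \<subseteq> M) \<and> (\<forall>i<n. \<forall>j<n. i \<noteq> j \<longrightarrow> S i \<inter> S j = {}) \<and>
      (\<forall>i. i \<ge> n \<longrightarrow> S i = {})"
  \<comment> \<open>The fixed value \<open>{}\<close> from index \<open>n\<close> on leaves only
    finitely many candidate allocations.\<close>
  have "finite (PiE_dflt {..<n} {} (\<lambda>_. Pow M))"
    using assms by (intro finite_PiE_dflt) auto
  then have "finite {S. ?P S}"
    by (rule finite_subset[rotated]) (auto simp: PiE_dflt_def)
  then have fin: "finite ((\<lambda>S. \<Sum>i<n. v i (S i)) ` {S. ?P S})" by (rule finite_imageI)
  have "(\<lambda>_. {}) \<in> {S. ?P S}" by simp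
  then have "(\<lambda>S. \<Sum>i<n. v i (S i)) ` {S. ?P S} \<noteq> {}"
    unfolding image_is_empty by (auto simp only: empty_iff)
  from Max_in[OF fin this] have "OPT n M v \<in> (\<lambda>S. \<Sum>i<n. v i (S i)) ` {S. ?P S}"
    unfolding OPT_def setcompr_eq_image .
  then obtain S where "?P S" "OPT n M v = (\<Sum>i<n. v i (S i))" by auto
  then show ?thesis by (intro exI[of _ S]) simp
qed

theorem theorem2:
  fixes n :: nat and M :: "'a set" and D :: "nat \<Rightarrow> 'a valuation pmf"
  assumes "finite M"
    and "\<forall>i<n. finite (set_pmf (D i))"
    and "\<forall>i<n. \<forall>v\<in>set_pmf (D i). xos M v"
  shows "\<exists>alg :: 'a online_alg.
           alg_welfare n M D alg \<ge> (1 - 1 / exp 1) *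
             measure_pmf.expectation (profile n D) (OPT n M)"
proof -
  \<comment> \<open>The choice depends on the profile alone, so the algorithm and the analysis share
    one tie-breaking rule.\<close>
  define S where "S v = (SOME S. (\<forall>i<n. S i \<subseteq> M) \<and> (\<forall>i<n. \<forall>k<n. i \<noteq> k \<longrightarrow> S i \<inter> S k = {}) \<and>
    OPT n M v = (\<Sum>i<n. v i (S i)))" for v :: "nat \<Rightarrow> 'a valuation"
  have "(\<forall>i<n. S v i \<subseteq> M) \<and> (\<forall>i<n. \<forall>k<n. i \<noteq> k \<longrightarrow> S v i \<inter> S v k = {}) \<and>
    OPT n M v = (\<Sum>i<n. v i (S v i))" for v
    unfolding S_def by (rule someI_ex[OF OPT_attained[OF assms(1)]])
  then have S: "\<And>v i. i < n \<Longrightarrow> S v i \<subseteq> M"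
      "\<And>v i k. i < n \<Longrightarrow> k < n \<Longrightarrow> i \<noteq> k \<Longrightarrow> S v i \<inter> S v k = {}"
    and OPT: "\<And>v. OPT n M v = (\<Sum>i<n. v i (S v i))"
    by blast+
  have xos: "xos M (v i)" if "v \<in> set_pmf (profile n D)" "i < n" for v i
    using that assms(3) by (auto simp: profile_def set_Pi_pmf PiE_dflt_def)
  define a where "a v i = (SOME w. (\<forall>j\<in>M. w j \<ge> 0) \<and> v i (S v i) = sum w (S v i)
      \<and> (\<forall>T\<subseteq>M. sum w T \<le> v i T))" for v i
  have a: "(\<forall>j\<in>M. a v i j \<ge> 0) \<and> v i (S v i) = sum (a v i) (S v i) \<and> (\<forall>T\<subseteq>M. sum (a v i) T \<le> v i T)"
    if "v \<in> set_pmf (profile n D)" "i < n" for v i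
    unfolding a_def by (rule someI_ex[OF xos_supporting_prices[OF xos[OF that] S(1)[OF that(2)]]])
  interpret item_assignment n M D S a
  proof
    show "sum (a v i) T \<le> v i T" if "v \<in> set_pmf (profile n D)" "i < n" "T \<subseteq> S v i" for v i T
      using a[OF that(1,2)] S(1)[OF that(2), of v] that(3) by blast
    show "a v i j \<ge> 0" if "v \<in> set_pmf (profile n D)" "i < n" "j \<in> M" for v i j
      using a[OF that(1,2)] that(3) by blast
  qed (use assms(1,2) S in blast)+
  have "measure_pmf.expectation (profile n D) (OPT n M)
      = measure_pmf.expectation (profile n D) (\<lambda>v. \<Sum>i<n. \<Sum>j\<in>S v i. a v i j)"
    using a by (intro integral_cong_AE) (auto simp: AE_measure_pmf_iff OPT)
  with alg_welfare_ge show ?thesis by auto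
qed

end
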